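(* Let $E=\mathrm{ind}_m E_m$ be an LF-space with stepwise Schauder basis $(e_j)_{j\in\mathbb{N}}$ and associated backward shift $B$. Assume that there is $m\in\mathbb{N}$ such that for every zero neighborhood $W$ in $E_m$ the set $I_W:=\{j\in\mathbb{N}: e_j\in W\}$ is syndetic. Then $B$ is topologically ergodic on $E$.
   Context: $\mathbb{N}=\{1,2,\dots\}$, and $\mathbb{K}\in\{\mathbb{R},\mathbb{C}\}$ is the scalar field. LF-space: an inductive spectrum of Fréchet spaces $(E_m)_{m\in\mathbb{N}}$ is an increasing sequence of Fréchet spaces such that each inclusion $E_m\subset E_{m+1}$ is continuous. Its inductive limit (LF-space) $E=\mathrm{ind}_m E_m$ is the union $\bigcup_m E_m$ with the finest locally convex topology making every inclusion $E_m\subset E$ continuous; this topology is assumed to be Hausdorff. Stepwise Schauder basis: a sequence $(e_j)_{j\in\mathbb{N}}$ in $E_1$ which is a Schauder basis of $E_m$ for every $m\in\mathbb{N}$. Associated backward shift: if the linear map on $\mathrm{span}\{e_j: j\in\mathbb{N}\}$ given by $Be_1:=0$, $Be_j:=e_{j-1}$ for $j\ge 2$, extends to a continuous linear map $B:E\to E$, then $B$ is called the backward shift associated with $(e_j)_j$. Saying that $E$ has associated backward shift $B$ means that this continuous extension exists. A set $A\subseteq\mathbb{N}$ is syndetic if there is $p\in\mathbb{N}$ such that $\{n,n+1,\dots,n+p\}\cap A\neq\emptyset$ for every $n\in\mathbb{N}$. A continuous linear operator $T$ on $E$ is topologically ergodic if for all non-empty open $U,V\subseteq E$ the set $\{n\in\mathbb{N}: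 T^n(U)\cap V\neq\emptyset\}$ is syndetic. *)

theory Defs
  imports "HOL-Analysis.Analysis"
begin

text \<open>
  The scalar field is a type of class \<^class>\<open>real_normed_field\<close>: the types \<^typ>\<open>real\<close> and
  \<^typ>\<open>complex\<close> are instances, and by Gelfand--Mazur every instance is isomorphic to one of them.
  All spaces are linear subspaces of one ambient vector space with scalar multiplication
  \<open>smul\<close> (assumed to satisfy \<^locale>\<open>vector_space\<close> where these notions are used); each carries
  its own topology, given as a value of type \<open>'a topology\<close> whose \<^const>\<open>topspace\<close> is the subspace.
  The set of natural numbers is \<open>{1..}\<close> throughout; values of sequences at index 0 play no role.
\<close>

definition convex_over :: "('k::real_normed_field \<Rightarrow> 'a::ab_group_add \<Rightarrow> 'a) \<Rightarrow> 'a set \<Rightarrow> bool" where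
  "convex_over smul C \<longleftrightarrow>
     (\<forall>x\<in>C. \<forall>y\<in>C. \<forall>t\<in>{0..1::real}. smul (of_real (1 - t)) x + smul (of_real t) y \<in> C)"

text \<open>Not required to be Hausdorff.\<close>

definition locally_convex_space ::
    "('k::real_normed_field \<Rightarrow> 'a::ab_group_add \<Rightarrow> 'a) \<Rightarrow> 'a topology \<Rightarrow> bool" where
  "locally_convex_space smul X \<longleftrightarrow>
     module.subspace smul (topspace X) \<and>
     continuous_map (prod_topology X X) X (\<lambda>(x, y). x + y) \<and>
     continuous_map (prod_topology euclidean X) X (\<lambda>(c, x). smul c x) \<and>
     neighbourhood_base_at 0 (convex_over smul) X"

text \<open>Completeness of a metrizable topological vector space refers to its translation-invariant
  compatible metrics.\<close>

definition frechet_space ::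
    "('k::real_normed_field \<Rightarrow> 'a::ab_group_add \<Rightarrow> 'a) \<Rightarrow> 'a topology \<Rightarrow> bool" where
  "frechet_space smul X \<longleftrightarrow>
     locally_convex_space smul X \<and>
     (\<exists>d. Metric_space (topspace X) d \<and>
          Metric_space.mtopology (topspace X) d = X \<and>
          Metric_space.mcomplete (topspace X) d \<and>
          (\<forall>x\<in>topspace X. \<forall>y\<in>topspace X. \<forall>z\<in>topspace X. d (x + z) (y + z) = d x y))"

definition inductive_spectrum ::
    "('k::real_normed_field \<Rightarrow> 'a::ab_group_add \<Rightarrow> 'a) \<Rightarrow> (nat \<Rightarrow> 'a topology) \<Rightarrow> bool" where
  "inductive_spectrum smul Es \<longleftrightarrow>
     (\<forall>m\<ge>1. frechet_space smul (Es m)) \<and>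
     (\<forall>m\<ge>1. topspace (Es m) \<subseteq> topspace (Es (m + 1)) \<and>
             continuous_map (Es m) (Es (m + 1)) (\<lambda>x. x))"

text \<open>\<open>E\<close> is the finest locally convex topology on the union of the steps for which all inclusions
  are continuous.\<close>

definition inductive_limit ::
    "('k::real_normed_field \<Rightarrow> 'a::ab_group_add \<Rightarrow> 'a) \<Rightarrow> (nat \<Rightarrow> 'a topology) \<Rightarrow> 'a topology \<Rightarrow> bool" where
  "inductive_limit smul Es E \<longleftrightarrow>
     topspace E = (\<Union>m\<in>{1..}. topspace (Es m)) \<and>
     locally_convex_space smul E \<and>
     (\<forall>m\<ge>1. continuous_map (Es m) E (\<lambda>x. x)) \<and>
     (\<forall>F. topspace F = topspace E \<and> locally_convex_space smul F \<and>
          (\<forall>m\<ge>1. continuous_map (Es m) F (\<lambda>x. x)) \<longrightarrow>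
          (\<forall>U. openin F U \<longrightarrow> openin E U))"

definition LF_space ::
    "('k::real_normed_field \<Rightarrow> 'a::ab_group_add \<Rightarrow> 'a) \<Rightarrow> (nat \<Rightarrow> 'a topology) \<Rightarrow> 'a topology \<Rightarrow> bool" where
  "LF_space smul Es E \<longleftrightarrow>
     inductive_spectrum smul Es \<and> inductive_limit smul Es E \<and> Hausdorff_space E"

text \<open>Coefficient sequences are functions on \<open>{1..}\<close>; \<^const>\<open>extensional\<close> fixes their irrelevant
  value at 0, so that uniqueness can be stated as equality of functions.\<close>

definition schauder_basis ::
    "('k::real_normed_field \<Rightarrow> 'a::ab_group_add \<Rightarrow> 'a) \<Rightarrow> 'a topology \<Rightarrow> (nat \<Rightarrow> 'a) \<Rightarrow> bool" where
  "schauder_basis smul X e \<longleftrightarrow>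
     (\<forall>j\<ge>1. e j \<in> topspace X) \<and>
     (\<forall>x\<in>topspace X. \<exists>!a. a \<in> extensional {1..} \<and>
        limitin X (\<lambda>n. \<Sum>j=1..n. smul (a j) (e j)) x sequentially)"

definition stepwise_schauder_basis ::
    "('k::real_normed_field \<Rightarrow> 'a::ab_group_add \<Rightarrow> 'a) \<Rightarrow> (nat \<Rightarrow> 'a topology) \<Rightarrow> (nat \<Rightarrow> 'a) \<Rightarrow> bool" where
  "stepwise_schauder_basis smul Es e \<longleftrightarrow>
     (\<forall>j\<ge>1. e j \<in> topspace (Es 1)) \<and> (\<forall>m\<ge>1. schauder_basis smul (Es m) e)"

definition continuous_linear_operator ::
    "('k::real_normed_field \<Rightarrow> 'a::ab_group_add \<Rightarrow> 'a) \<Rightarrow> 'a topology \<Rightarrow> ('a \<Rightarrow> 'a) \<Rightarrow> bool" where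
  "continuous_linear_operator smul X T \<longleftrightarrow>
     continuous_map X X T \<and>
     (\<forall>x\<in>topspace X. \<forall>y\<in>topspace X. T (x + y) = T x + T y) \<and>
     (\<forall>c. \<forall>x\<in>topspace X. T (smul c x) = smul c (T x))"

text \<open>A linear map extends the shift on the span of the \<open>e j\<close> iff it has the prescribed values on
  the \<open>e j\<close>. The values of \<open>B\<close> outside \<open>topspace E\<close> are arbitrary.\<close>

definition associated_backward_shift ::
    "('k::real_normed_field \<Rightarrow> 'a::ab_group_add \<Rightarrow> 'a) \<Rightarrow> 'a topology \<Rightarrow> (nat \<Rightarrow> 'a) \<Rightarrow> ('a \<Rightarrow> 'a) \<Rightarrow> bool" where
  "associated_backward_shift smul E e B \<longleftrightarrow>
     continuous_linear_operator smul E B \<and> B (e 1) = 0 \<and> (\<forall>j\<ge>2. B (e j) = e (j - 1))"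

definition zero_neighborhood :: "'a::ab_group_add topology \<Rightarrow> 'a set \<Rightarrow> bool" where
  "zero_neighborhood X W \<longleftrightarrow> W \<subseteq> topspace X \<and> (\<exists>U. openin X U \<and> 0 \<in> U \<and> U \<subseteq> W)"

definition syndetic :: "nat set \<Rightarrow> bool" where
  "syndetic A \<longleftrightarrow> A \<subseteq> {1..} \<and> (\<exists>p\<ge>1. \<forall>n\<ge>1. {n..n + p} \<inter> A \<noteq> {})"

definition topologically_ergodic ::
    "('k::real_normed_field \<Rightarrow> 'a::ab_group_add \<Rightarrow> 'a) \<Rightarrow> 'a topology \<Rightarrow> ('a \<Rightarrow> 'a) \<Rightarrow> bool" where
  "topologically_ergodic smul X T \<longleftrightarrow>
     continuous_linear_operator smul X T \<and>
     (\<forall>U V. openin X U \<and> U \<noteq> {} \<and> openin X V \<and> V \<noteq> {} \<longrightarrow>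
        syndetic {n. n \<ge> 1 \<and> (T ^^ n) ` U \<inter> V \<noteq> {}})"

end

theory Submission
  imports Defs
begin

text \<open>
  Finite linear combinations of the \<open>e j\<close> are dense in \<open>E\<close> (\<open>span_meets_open\<close>), so given non-empty
  open sets \<open>U\<close> and \<open>V\<close> one may pick
  \<open>u = (\<Sum>j=1..M. a j e j) \<in> U\<close> and \<open>v = (\<Sum>j=1..N. b j e j) \<in> V\<close>.
  The polynomial \<open>S = (\<Sum>j=1..N. b j B^(N - j))\<close> in \<open>B\<close> is continuous on \<open>E\<close>, vanishes at 0, and
  maps \<open>e (n + N)\<close> to \<open>\<Sum>j=1..N. b j e (j + n)\<close>. If \<open>n \<ge> M\<close>, then \<open>B^n\<close> annihilates \<open>u\<close> and
  sends \<open>S (e (n + N))\<close> to \<open>v\<close>, so \<open>B^n\<close> maps \<open>u + S (e (n + N))\<close> to \<open>v \<in> V\<close>. This vector lies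
  in \<open>U\<close> as soon as \<open>e (n + N)\<close> lies in the zero neighbourhood \<open>W = {x. u + S x \<in> U}\<close> of \<open>E\<close>.
  For the given \<open>m\<close>, the trace of \<open>W\<close> on the step \<open>Es m\<close> is a zero neighbourhood there, because the inclusion is continuous,
  so the indices \<open>j\<close> with \<open>e j \<in> W\<close> form a syndetic set; its translate by \<open>-N\<close>, restricted to
  \<open>n \<ge> M\<close>, is still syndetic.
\<close>

section \<open>Locally convex spaces and operators on them\<close>

lemma continuous_map_lcs_add:
  assumes "locally_convex_space smul X" "continuous_map Y X f" "continuous_map Y X g"
  shows "continuous_map Y X (\<lambda>x. f x + g x)"
proof -
  have "continuous_map (prod_topology X X) X (\<lambda>(x, y). x + y)"
    using assms(1) by (simp add: locally_convex_space_def)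
  moreover have "continuous_map Y (prod_topology X X) (\<lambda>x. (f x, g x))"
    using assms(2,3) by (simp add: continuous_map_pairedI)
  ultimately show ?thesis
    by (auto dest: continuous_map_compose simp: o_def)
qed

lemma continuous_map_lcs_smul:
  assumes "locally_convex_space smul X" "continuous_map Y X f"
  shows "continuous_map Y X (\<lambda>x. smul c (f x))"
proof -
  have "continuous_map (prod_topology euclidean X) X (\<lambda>(c, x). smul c x)"
    using assms(1) by (simp add: locally_convex_space_def)
  moreover have "continuous_map Y (prod_topology euclidean X) (\<lambda>x. (c, f x))"
    using assms(2) by (simp add: continuous_map_pairedI)
  ultimately show ?thesis
    by (auto dest: continuous_map_compose simp: o_def)
qed

lemma subspace_topspace_lcs:
  "locally_convex_space smul X \<Longrightarrow> module.subspace smul (topspace X)"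
  by (simp add: locally_convex_space_def)

lemma continuous_map_lcs_sum:
  assumes "vector_space smul" "locally_convex_space smul X"
    and "\<And>i. i \<in> I \<Longrightarrow> continuous_map Y X (f i)"
  shows "continuous_map Y X (\<lambda>x. \<Sum>i\<in>I. f i x)"
proof -
  interpret vector_space smul by fact
  have zero: "0 \<in> topspace X"
    using subspace_topspace_lcs[OF assms(2)] by (rule subspace_0)
  show ?thesis
    using assms(3)
    by (induction I rule: infinite_finite_induct)
      (simp_all add: zero continuous_map_lcs_add[OF assms(2)])
qed

lemma continuous_linear_operator_closed:
  assumes "continuous_linear_operator smul X T" "x \<in> topspace X"
  shows "T x \<in> topspace X"
  using assms by (auto simp: continuous_linear_operator_def continuous_map_def)

lemma continuous_linear_operator_funpow:
  assumes "continuous_linear_operator smul X T"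
  shows "continuous_linear_operator smul X (T ^^ n)"
proof (induction n)
  case 0
  show ?case by (simp add: continuous_linear_operator_def id_def)
next
  case (Suc n)
  have "continuous_map X X (T \<circ> (T ^^ n))"
    using assms Suc by (auto simp: continuous_linear_operator_def intro: continuous_map_compose)
  with assms Suc show ?case
    by (simp add: continuous_linear_operator_def continuous_map_def Pi_iff)
qed

lemma continuous_linear_operator_zero:
  assumes "vector_space smul" "locally_convex_space smul X" "continuous_linear_operator smul X T"
  shows "T 0 = 0"
proof -
  interpret vector_space smul by fact
  have "0 \<in> topspace X"
    using subspace_topspace_lcs[OF assms(2)] by (rule subspace_0)
  hence "T (0 + 0) = T 0 + T 0"
    using assms(3) unfolding continuous_linear_operator_def by blast
  thus ?thesis by simp
qed

lemma continuous_linear_operator_sum: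
  assumes "vector_space smul" "locally_convex_space smul X" "continuous_linear_operator smul X T"
    and "\<And>i. i \<in> I \<Longrightarrow> x i \<in> topspace X"
  shows "T (\<Sum>i\<in>I. smul (c i) (x i)) = (\<Sum>i\<in>I. smul (c i) (T (x i)))"
proof -
  interpret vector_space smul by fact
  note sub = subspace_topspace_lcs[OF assms(2)]
  show ?thesis
    using assms(4)
  proof (induction I rule: infinite_finite_induct)
    case (insert i I)
    have "smul (c i) (x i) \<in> topspace X" "(\<Sum>i\<in>I. smul (c i) (x i)) \<in> topspace X"
      using insert.prems by (auto intro!: subspace_sum[OF sub] subspace_scale[OF sub])
    with insert assms(3) show ?case
      by (simp add: continuous_linear_operator_def)
  qed (simp_all add: continuous_linear_operator_zero[OF assms(1-3)])
qed

section \<open>Schauder bases and backward shifts\<close>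

text \<open>A point of \<open>E\<close> lies in some step, and the convergence of its basis expansion there
  carries over to \<open>E\<close>.\<close>

lemma span_meets_open:
  assumes "LF_space smul Es E" "stepwise_schauder_basis smul Es e"
    and "openin E U" "U \<noteq> {}"
  obtains N a where "(\<Sum>j=1..N. smul (a j) (e j)) \<in> U"
proof -
  obtain x where x: "x \<in> U" using assms(4) by blast
  have lim: "inductive_limit smul Es E" using assms(1) by (simp add: LF_space_def)
  have "x \<in> topspace E" using x openin_subset[OF assms(3)] by blast
  then obtain m where m: "m \<ge> 1" "x \<in> topspace (Es m)"
    using lim by (auto simp: inductive_limit_def)
  have "schauder_basis smul (Es m) e"
    using assms(2) m(1) by (simp add: stepwise_schauder_basis_def)
  then obtain a where "limitin (Es m) (\<lambda>n. \<Sum>j=1..n. smul (a j) (e j)) x sequentially"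
    using m(2) unfolding schauder_basis_def by blast
  moreover have "continuous_map (Es m) E (\<lambda>x. x)"
    using lim m(1) by (simp add: inductive_limit_def)
  ultimately have "limitin E (\<lambda>n. \<Sum>j=1..n. smul (a j) (e j)) x sequentially"
    by (auto dest: continuous_map_limit simp: o_def)
  hence "\<forall>\<^sub>F n in sequentially. (\<Sum>j=1..n. smul (a j) (e j)) \<in> U"
    using assms(3) x by (simp add: limitin_def)
  thus ?thesis
    using that by (auto simp: eventually_sequentially)
qed

lemma backward_shift_funpow:
  assumes "vector_space smul" "locally_convex_space smul E"
    and "associated_backward_shift smul E e B" and "j \<ge> 1"
  shows "(B ^^ n) (e j) = (if n < j then e (j - n) else 0)"
proof (induction n)
  case 0
  show ?case using assms(4) by simp
next
  case (Suc n)
  have B: "B (e 1) = 0" "\<And>i. i \<ge> 2 \<Longrightarrow> B (e i) = e (i - 1)" "B 0 = 0"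
    using assms(3) continuous_linear_operator_zero[OF assms(1,2)]
    by (auto simp: associated_backward_shift_def)
  consider "Suc n < j" | "j = Suc n" | "j < Suc n" by linarith
  thus ?case
    by cases (use Suc B in auto)
qed

section \<open>Ergodicity\<close>

text \<open>In the application, \<open>R\<close> is a set of return times, and only \<open>n \<ge> M\<close> with \<open>n + N \<in> A\<close> are
  known to belong to it.\<close>

lemma syndetic_shift:
  assumes "syndetic A" "R \<subseteq> {1..}"
    and R: "\<And>n. n \<ge> 1 \<Longrightarrow> n \<ge> M \<Longrightarrow> n + N \<in> A \<Longrightarrow> n \<in> R"
  shows "syndetic R"
proof -
  obtain p where p: "p \<ge> 1" "\<And>n. n \<ge> 1 \<Longrightarrow> {n..n + p} \<inter> A \<noteq> {}"
    using assms(1) by (auto simp: syndetic_def)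
  have "{n..n + (M + p)} \<inter> R \<noteq> {}" if n: "n \<ge> 1" for n
  proof -
    obtain j where j: "j \<in> A" "n + M + N \<le> j" "j \<le> n + M + N + p"
      using p(2)[of "n + M + N"] n by auto
    have "j - N \<in> R"
      by (rule R) (use j n in auto)
    moreover have "j - N \<in> {n..n + (M + p)}"
      using j by auto
    ultimately show ?thesis by blast
  qed
  moreover have "M + p \<ge> 1" using p(1) by simp
  ultimately show ?thesis
    using assms(2) unfolding syndetic_def by blast
qed

theorem proposition2p9:
  fixes smul :: "'k::real_normed_field \<Rightarrow> 'a::ab_group_add \<Rightarrow> 'a"
    and Es :: "nat \<Rightarrow> 'a topology"
    and E :: "'a topology"
    and e :: "nat \<Rightarrow> 'a"
    and B :: "'a \<Rightarrow> 'a"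
  assumes "vector_space smul"
    and "LF_space smul Es E"
    and "stepwise_schauder_basis smul Es e"
    and "associated_backward_shift smul E e B"
    and "\<exists>m\<ge>1. \<forall>W. zero_neighborhood (Es m) W \<longrightarrow> syndetic {j. j \<ge> 1 \<and> e j \<in> W}"
  shows "topologically_ergodic smul E B"
proof -
  interpret vector_space smul by fact
  have lim: "inductive_limit smul Es E" using assms(2) by (simp add: LF_space_def)
  hence lcs: "locally_convex_space smul E" by (simp add: inductive_limit_def)
  note sub = subspace_topspace_lcs[OF lcs]
  have B: "continuous_linear_operator smul E B"
    using assms(4) by (simp add: associated_backward_shift_def)
  note Bn = continuous_linear_operator_funpow[OF B]
  note Bn_sum = continuous_linear_operator_sum[OF assms(1) lcs Bn]
  note shift = backward_shift_funpow[OF assms(1) lcs assms(4)]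
  have e: "e j \<in> topspace E" if "j \<ge> 1" for j
    using that assms(3) lim by (auto simp: stepwise_schauder_basis_def inductive_limit_def)
  obtain m where m: "m \<ge> 1"
    and syn: "\<And>W. zero_neighborhood (Es m) W \<Longrightarrow> syndetic {j. j \<ge> 1 \<and> e j \<in> W}"
    using assms(5) by blast
  have incl: "continuous_map (Es m) E (\<lambda>x. x)"
    using lim m by (simp add: inductive_limit_def)
  have zero_m: "0 \<in> topspace (Es m)"
    using assms(2) m subspace_0 subspace_topspace_lcs
    by (auto simp: LF_space_def inductive_spectrum_def frechet_space_def)
  have "syndetic {n. n \<ge> 1 \<and> (B ^^ n) ` U \<inter> V \<noteq> {}}"
    if U: "openin E U" "U \<noteq> {}" and V: "openin E V" "V \<noteq> {}" for U V
  proof -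
    obtain M a where u: "(\<Sum>j=1..M. smul (a j) (e j)) \<in> U" (is "?u \<in> U")
      using span_meets_open[OF assms(2,3) U] by blast
    obtain N b where v: "(\<Sum>j=1..N. smul (b j) (e j)) \<in> V" (is "?v \<in> V")
      using span_meets_open[OF assms(2,3) V] by blast
    have uE: "?u \<in> topspace E" using u openin_subset[OF U(1)] by blast
    define S where "S x = (\<Sum>j=1..N. smul (b j) ((B ^^ (N - j)) x))" for x
    have "continuous_map E E S"
      unfolding S_def using Bn
      by (intro continuous_map_lcs_sum[OF assms(1) lcs] continuous_map_lcs_smul[OF lcs])
        (simp add: continuous_linear_operator_def)
    hence "continuous_map E E (\<lambda>x. ?u + S x)"
      by (intro continuous_map_lcs_add[OF lcs]) (use uE in simp_all)
    hence cont: "continuous_map (Es m) E (\<lambda>x. ?u + S x)"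
      using incl by (auto dest: continuous_map_compose simp: o_def)
    \<comment> \<open>The set \<open>W\<close> is formed directly inside the step on which the syndeticity hypothesis holds.\<close>
    define W where "W = {x \<in> topspace (Es m). ?u + S x \<in> U}"
    have "S 0 = 0"
      by (simp add: S_def continuous_linear_operator_zero[OF assms(1) lcs Bn])
    hence "0 \<in> W" using u zero_m by (simp add: W_def)
    moreover have "openin (Es m) W"
      unfolding W_def using cont U(1) by (rule openin_continuous_map_preimage)
    ultimately have "zero_neighborhood (Es m) W"
      by (auto simp: zero_neighborhood_def W_def)
    hence "syndetic {j. j \<ge> 1 \<and> e j \<in> W}" by (rule syn)
    thus ?thesis
    proof (rule syndetic_shift[where M = M and N = N])
      fix n assume n: "n \<ge> 1" "n \<ge> M" "n + N \<in> {j. j \<ge> 1 \<and> e j \<in> W}"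
      have S_e: "S (e (n + N)) = (\<Sum>j=1..N. smul (b j) (e (j + n)))"
        unfolding S_def using n(1) by (intro sum.cong) (auto simp: shift add.commute)
      have "(B ^^ n) ?u = (\<Sum>j=1..M. smul (a j) ((B ^^ n) (e j)))"
        using e by (intro Bn_sum) simp
      also have "\<dots> = 0"
        using n(2) by (intro sum.neutral) (auto simp: shift)
      finally have Bu: "(B ^^ n) ?u = 0" .
      have "(B ^^ n) (S (e (n + N))) = (\<Sum>j=1..N. smul (b j) ((B ^^ n) (e (j + n))))"
        unfolding S_e using e by (intro Bn_sum) simp
      also have "\<dots> = ?v"
        by (intro sum.cong) (auto simp: shift)
      finally have BS: "(B ^^ n) (S (e (n + N))) = ?v" .
      have "S (e (n + N)) \<in> topspace E"
        unfolding S_e using e by (auto intro!: subspace_sum[OF sub] subspace_scale[OF sub])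
      hence "(B ^^ n) (?u + S (e (n + N))) = ?v"
        using Bn[of n] uE Bu BS by (simp add: continuous_linear_operator_def)
      moreover have "?u + S (e (n + N)) \<in> U"
        using n(3) by (simp add: W_def)
      ultimately have "(B ^^ n) ` U \<inter> V \<noteq> {}"
        using v by (metis IntI empty_iff imageI)
      with n(1) show "n \<in> {n. n \<ge> 1 \<and> (B ^^ n) ` U \<inter> V \<noteq> {}}" by simp
    qed auto
  qed
  with B show ?thesis
    by (auto simp: topologically_ergodic_def)
qed

end
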